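(* Let $d,l$ be non-negative integers with $2d\leqslant l$, and let $f:\mathbb{N}\to\mathbb{R}$ be a function of the form $$f(n)=c_{l}n^{l}+c_{l-1}n^{l-1}+\cdots+c_{l-2d}n^{l-2d}+o(n^{l-2d})\qquad (n\to\infty),$$ where $c_l,c_{l-1},\ldots,c_{l-2d}$ are real constants (independent of $n$) and $c_l\neq 0$. Then, for every integer $0\leqslant j\leqslant d$, the sequence $(f(n))_{n=0}^\infty$ satisfies the Laguerre inequality of order $j$ at $n$ for all but finitely many values of $n\in\mathbb{N}$. In particular, $$\sum_{i=0}^{2d}(-1)^{i+d}\binom{2d}{i}f(n+i)f(n+2d-i)=(2d)!\binom{l}{d}c_l^2n^{2(l-d)}+o\left(n^{2(l-d)}\right)\qquad (n\to\infty).$$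
   Context: $\mathbb{N}$ denotes the set of non-negative integers. For a fixed non-negative integer $d$, a sequence $\omega=(\omega_i)_{i=0}^\infty$ of real numbers satisfies the Laguerre inequality of order $d$ at $n$ if $$\sum_{i=0}^{2d}(-1)^{i+d}\binom{2d}{i}\omega_{n+i}\,\omega_{n+2d-i}\geqslant0.$$ *)

theory Defs
  imports Complex_Main "HOL-Library.Landau_Symbols"
begin

definition laguerre_expr :: "nat \<Rightarrow> (nat \<Rightarrow> real) \<Rightarrow> nat \<Rightarrow> real" where
  "laguerre_expr d \<omega> n =
     (\<Sum>i=0..2*d. (-1) ^ (i + d) * real ((2*d) choose i) * \<omega> (n + i) * \<omega> (n + 2*d - i))"

definition satisfies_laguerre :: "nat \<Rightarrow> (nat \<Rightarrow> real) \<Rightarrow> nat \<Rightarrow> bool" where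
  "satisfies_laguerre d \<omega> n \<longleftrightarrow> laguerre_expr d \<omega> n \<ge> 0"

end

theory Submission
  imports Defs "HOL-Computational_Algebra.Polynomial"
begin

text \<open>
  The Laguerre expression is the diagonal of a bilinear form in sequences
  (\<open>laguerre_form\<close>), and the proof evaluates this form on powers of \<open>n\<close>.
  Expanding \<open>(n + i)^k (n + 2d - i)^m\<close> in powers of \<open>n\<close>, the coefficient of
  \<open>n^(k + m - a - b)\<close> carries the factor \<open>i^a (2d - i)^b\<close>. The alternating binomial weights
  form a difference operator of order \<open>2d\<close> in \<open>i\<close>: it annihilates this factor when \<open>a + b < 2d\<close>
  and returns its leading coefficient times \<open>(2d)!\<close> when \<open>a + b = 2d\<close>. Hence the top \<open>2d\<close> orders
  in \<open>n\<close> cancel, and the form on \<open>n^k\<close>, \<open>n^m\<close> is a constant times \<open>n^(k + m - 2d)\<close>, up to lower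
  order (\<open>laguerre_form_powers_asymp\<close>).

  Of all the pairs \<open>k, m \<le> l\<close> only \<open>k = m = l\<close> then reaches the order \<open>n^(2(l - d))\<close>. Its
  constant is \<open>(-1)^d (2d)!\<close> times the coefficient of \<open>x^(2d)\<close> in
  \<open>(1 + x)^l (1 - x)^l = (1 - x^2)^l\<close>, which is \<open>(-1)^d\<close> times \<open>l\<close> choose \<open>d\<close>
  (\<open>alternating_vandermonde_diagonal\<close>). The error term of the expansion is paired with sequences
  of size \<open>O(n^l)\<close>, so it contributes \<open>o(n^l n^(l - 2d)) = o(n^(2(l - d)))\<close> term by term: this is
  where the expansion has to reach down to \<open>n^(l - 2d)\<close>.

  An expansion to depth \<open>2d\<close> truncates to one of depth \<open>2j\<close> for every \<open>j \<le> d\<close>, so the same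
  asymptotics hold at order \<open>j\<close>; as the leading constant is positive, the Laguerre inequality of
  order \<open>j\<close> holds eventually.
\<close>

section \<open>Alternating binomial sums of polynomials\<close>

text \<open>
  Up to sign, this is the \<open>N\<close>-th finite difference at \<open>0\<close> of a power. One factor \<open>i\<close> is
  absorbed into the binomial coefficient, which lowers \<open>N\<close> and shifts the summation index; the
  shifted power is then expanded into powers of smaller exponent.
\<close>

lemma alternating_binomial_sum_power:
  assumes "r \<le> N"
  shows "(\<Sum>i\<le>N. (-1) ^ i * real (N choose i) * real i ^ r)
    = (if r = N then (-1) ^ N * fact N else 0)"
  using assms
proof (induction N arbitrary: r)
  case 0
  then show ?case by simp
next
  case (Suc N)
  show ?case
  proof (cases r)
    case 0
    then show ?thesis
      using choose_alternating_sum[of "Suc N", where ?'a = real] by simp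
  next
    case (Suc s)
    with Suc.prems have s: "s \<le> N" by simp
    have absorb: "real (Suc N choose Suc j) * real (Suc j) = real (Suc N) * real (N choose j)" for j
      using Suc_times_binomial_eq[of N j] by (metis of_nat_mult)
    have "(\<Sum>i\<le>Suc N. (-1) ^ i * real (Suc N choose i) * real i ^ r)
        = (\<Sum>j\<le>N. (-1) ^ Suc j * real (Suc N choose Suc j) * real (Suc j) ^ Suc s)"
      unfolding Suc by (subst sum.atMost_Suc_shift) simp
    also have "\<dots> = (\<Sum>j\<le>N. (-1) ^ Suc j * (real (Suc N choose Suc j) * real (Suc j)) * real (Suc j) ^ s)"
      by (simp only: power_Suc mult_ac)
    also have "\<dots> = - real (Suc N) * (\<Sum>j\<le>N. (-1) ^ j * real (N choose j) * (real j + 1) ^ s)"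
      unfolding absorb by (simp add: sum_distrib_left sum_negf[symmetric] algebra_simps)
    also have "(\<Sum>j\<le>N. (-1) ^ j * real (N choose j) * (real j + 1) ^ s)
        = (\<Sum>j\<le>N. \<Sum>a\<le>s. real (s choose a) * ((-1) ^ j * real (N choose j) * real j ^ a))"
      by (simp add: binomial_ring sum_distrib_left mult_ac)
    also have "\<dots> = (\<Sum>a\<le>s. real (s choose a) * (\<Sum>j\<le>N. (-1) ^ j * real (N choose j) * real j ^ a))"
      by (subst sum.swap) (simp add: sum_distrib_left)
    also have "\<dots> = (\<Sum>a\<le>s. real (s choose a) * (if a = N then (-1) ^ N * fact N else 0))"
      using s by (intro sum.cong refl) (simp add: Suc.IH)
    also have "\<dots> = (if s = N then (-1) ^ N * fact N else 0)"
    proof (cases "s = N")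
      case True
      then show ?thesis by (simp add: if_distrib cong: if_cong)
    next
      case False
      with s show ?thesis by (auto intro!: sum.neutral)
    qed
    also have "- real (Suc N) * (if s = N then (-1) ^ N * fact N else 0)
        = (if r = Suc N then (-1) ^ Suc N * fact (Suc N) else 0)"
      using Suc by (simp add: algebra_simps)
    finally show ?thesis .
  qed
qed

lemma alternating_binomial_sum_poly:
  fixes p :: "real poly"
  assumes "degree p \<le> N"
  shows "(\<Sum>i\<le>N. (-1) ^ i * real (N choose i) * poly p (real i)) = (-1) ^ N * fact N * coeff p N"
proof -
  have "poly p x = (\<Sum>r\<le>N. coeff p r * x ^ r)" for x
    unfolding poly_altdef using assms
    by (intro sum.mono_neutral_left) (auto simp: coeff_eq_0 not_le)
  then have "(\<Sum>i\<le>N. (-1) ^ i * real (N choose i) * poly p (real i))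
      = (\<Sum>i\<le>N. \<Sum>r\<le>N. coeff p r * ((-1) ^ i * real (N choose i) * real i ^ r))"
    by (simp add: sum_distrib_left mult_ac)
  also have "\<dots> = (\<Sum>r\<le>N. coeff p r * (\<Sum>i\<le>N. (-1) ^ i * real (N choose i) * real i ^ r))"
    by (subst sum.swap) (simp add: sum_distrib_left)
  also have "\<dots> = (\<Sum>r\<le>N. coeff p r * (if r = N then (-1) ^ N * fact N else 0))"
    by (intro sum.cong refl) (simp add: alternating_binomial_sum_power)
  also have "\<dots> = (-1) ^ N * fact N * coeff p N"
    by (simp add: if_distrib cong: if_cong)
  finally show ?thesis .
qed

text \<open>
  On the range of summation the reflected factor is the linear polynomial \<open>N - x\<close>, so the
  summand is a polynomial of degree \<open>a + b\<close> with leading coefficient \<open>(-1)^b\<close>.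
\<close>

lemma alternating_binomial_sum_power_reflected:
  assumes "a + b \<le> N"
  shows "(\<Sum>i\<le>N. (-1) ^ i * real (N choose i) * (real i ^ a * real (N - i) ^ b))
    = (if a + b = N then (-1) ^ (N + b) * fact N else 0)"
proof -
  define p :: "real poly" where "p = monom 1 a * [:real N, -1:] ^ b"
  have deg: "degree p = a + b"
    unfolding p_def by (simp add: degree_mult_eq degree_power_eq degree_monom_eq)
  have "lead_coeff p = (-1) ^ b"
    unfolding p_def by (simp add: lead_coeff_mult lead_coeff_power degree_monom_eq)
  then have coeff_p: "coeff p N = (if a + b = N then (-1) ^ b else 0)"
    using deg assms by (auto simp: coeff_eq_0)
  have "(\<Sum>i\<le>N. (-1) ^ i * real (N choose i) * (real i ^ a * real (N - i) ^ b))
      = (\<Sum>i\<le>N. (-1) ^ i * real (N choose i) * poly p (real i))"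
    by (intro sum.cong refl) (simp add: p_def poly_monom of_nat_diff)
  also have "\<dots> = (-1) ^ N * fact N * coeff p N"
    using deg assms by (intro alternating_binomial_sum_poly) simp
  finally show ?thesis
    by (simp add: coeff_p power_add)
qed

lemma coeff_one_plus_monom_power:
  fixes c :: real
  shows "coeff ((1 + monom c m) ^ l) n = (\<Sum>k\<le>l. if m * k = n then real (l choose k) * c ^ k else 0)"
proof -
  have "(1 + monom c m) ^ l = (\<Sum>k\<le>l. of_nat (l choose k) * monom (c ^ k) (m * k))"
    by (subst add.commute) (simp add: binomial_ring monom_power)
  also have "\<dots> = (\<Sum>k\<le>l. monom (real (l choose k) * c ^ k) (m * k))"
    by (simp add: of_nat_poly smult_monom)
  finally show ?thesis
    by (simp add: coeff_sum)
qed

text \<open>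
  Both sides are the coefficient of \<open>x^(2d)\<close> in \<open>(1 + x)^l (1 - x)^l = (1 - x^2)^l\<close>.
\<close>

lemma alternating_vandermonde_diagonal:
  assumes "d \<le> l"
  shows "(\<Sum>a\<le>l. \<Sum>b\<le>l. if a + b = 2 * d then (-1) ^ b * real (l choose a) * real (l choose b) else 0)
    = (-1) ^ d * real (l choose d)"
proof -
  have "(1 + monom 1 1) * (1 + monom (-1) 1) = (1 + monom (-1) 2 :: real poly)"
    by (simp add: algebra_simps mult_monom minus_monom[symmetric] numeral_2_eq_2)
  then have factor: "(1 + monom 1 1) ^ l * (1 + monom (-1) 1) ^ l = (1 + monom (-1) 2 :: real poly) ^ l"
    by (metis power_mult_distrib)
  have pos: "(1 + monom 1 1 :: real poly) ^ l = (\<Sum>a\<le>l. monom (real (l choose a)) a)"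
    by (subst add.commute) (simp add: binomial_ring monom_power of_nat_poly smult_monom)
  have neg: "(1 + monom (-1) 1 :: real poly) ^ l = (\<Sum>b\<le>l. monom ((-1) ^ b * real (l choose b)) b)"
    by (subst add.commute) (simp add: binomial_ring monom_power of_nat_poly smult_monom mult_ac)
  have "(\<Sum>a\<le>l. \<Sum>b\<le>l. if a + b = 2 * d then (-1) ^ b * real (l choose a) * real (l choose b) else 0)
      = coeff ((1 + monom 1 1) ^ l * (1 + monom (-1) 1) ^ l) (2 * d)"
    unfolding pos neg by (simp add: sum_product mult_monom coeff_sum mult_ac cong: if_cong)
  also have "\<dots> = (-1) ^ d * real (l choose d)"
    unfolding factor coeff_one_plus_monom_power using assms by (simp add: mult_ac)
  finally show ?thesis .
qed

section \<open>The Laguerre expression as a bilinear form\<close>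

text \<open>
  The index of \<open>h\<close> is bracketed so that it is visibly a shift of \<open>n\<close> by a constant.
\<close>

definition laguerre_form :: "nat \<Rightarrow> (nat \<Rightarrow> real) \<Rightarrow> (nat \<Rightarrow> real) \<Rightarrow> nat \<Rightarrow> real" where
  "laguerre_form d g h n =
     (\<Sum>i\<le>2*d. (-1) ^ (i + d) * real ((2*d) choose i) * (g (n + i) * h (n + (2*d - i))))"

lemma laguerre_expr_eq_form: "laguerre_expr d g n = laguerre_form d g g n"
  unfolding laguerre_expr_def laguerre_form_def atLeast0AtMost
  by (intro sum.cong refl) (simp add: mult.assoc)

lemma laguerre_form_add_left:
  "laguerre_form d (\<lambda>n. g n + g' n) h n = laguerre_form d g h n + laguerre_form d g' h n"
  unfolding laguerre_form_def by (simp add: algebra_simps sum.distrib)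

lemma laguerre_form_add_right:
  "laguerre_form d g (\<lambda>n. h n + h' n) n = laguerre_form d g h n + laguerre_form d g h' n"
  unfolding laguerre_form_def by (simp add: algebra_simps sum.distrib)

lemma laguerre_form_sum_left:
  "laguerre_form d (\<lambda>n. \<Sum>k\<in>A. c k * g k n) h n = (\<Sum>k\<in>A. c k * laguerre_form d (g k) h n)"
  unfolding laguerre_form_def
  by (simp add: sum_distrib_left sum_distrib_right mult_ac) (rule sum.swap)

lemma laguerre_form_sum_right:
  "laguerre_form d g (\<lambda>n. \<Sum>k\<in>A. c k * h k n) n = (\<Sum>k\<in>A. c k * laguerre_form d g (h k) n)"
  unfolding laguerre_form_def
  by (simp add: sum_distrib_left sum_distrib_right mult_ac) (rule sum.swap)

text \<open>
  Growth bounds by powers of \<open>n\<close> survive a constant shift of the index, so they pass from the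
  two arguments to the form term by term.
\<close>

lemma shift_power_bigo: "(\<lambda>n. real (n + s) ^ q) \<in> O(\<lambda>n. real n ^ q)"
proof -
  have "(\<lambda>n. real (n + s)) \<in> O(real)"
  proof (rule bigoI)
    show "eventually (\<lambda>n. norm (real (n + s)) \<le> (1 + real s) * norm (real n)) sequentially"
      using eventually_ge_at_top[of 1]
    proof eventually_elim
      case (elim n)
      then have "real s * 1 \<le> real s * real n"
        by (intro mult_left_mono) auto
      then show ?case by (simp add: algebra_simps)
    qed
  qed
  then show ?thesis by (rule landau_o.big_power)
qed

lemma power_smallo_power:
  assumes "p < q"
  shows "(\<lambda>n. real n ^ p) \<in> o(\<lambda>n. real n ^ q)"
proof -
  have "(\<lambda>n. real n) \<in> \<omega>(\<lambda>_. 1)"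
    by (intro smallomegaI_filterlim_at_top_norm) (simp add: filterlim_real_sequentially)
  then have one: "(\<lambda>_. 1 :: real) \<in> o(real)"
    by (simp add: smallomega_iff_smallo)
  have "(\<lambda>n. 1 ^ (q - p)) \<in> o(\<lambda>n. real n ^ (q - p))"
    using one assms by (intro landau_o.small_power) auto
  from landau_o.big_small_mult[OF landau_o.big_refl[of "\<lambda>n. real n ^ p"] this] assms show ?thesis
    by (simp add: power_add[symmetric])
qed

lemma power_bigo_power:
  assumes "p \<le> q"
  shows "(\<lambda>n. real n ^ p) \<in> O(\<lambda>n. real n ^ q)"
  using assms power_smallo_power[of p q] by (cases "p = q") (auto intro: landau_o.small_imp_big)

lemma shift_bigo:
  assumes "g \<in> O(\<lambda>n. real n ^ q)"
  shows "(\<lambda>n. g (n + s)) \<in> O(\<lambda>n. real n ^ q)"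
proof -
  have "(\<lambda>n. g (n + s)) \<in> O(\<lambda>n. real (n + s) ^ q)"
    by (rule landau_o.big.compose[OF assms]) (rule filterlim_add_const_nat_at_top)
  then show ?thesis using shift_power_bigo landau_o.big_trans by blast
qed

lemma shift_smallo:
  assumes "g \<in> o(\<lambda>n. real n ^ q)"
  shows "(\<lambda>n. g (n + s)) \<in> o(\<lambda>n. real n ^ q)"
proof -
  have "(\<lambda>n. g (n + s)) \<in> o(\<lambda>n. real (n + s) ^ q)"
    by (rule landau_o.small.compose[OF assms]) (rule filterlim_add_const_nat_at_top)
  then show ?thesis using shift_power_bigo landau_o.small_big_trans by blast
qed

lemma laguerre_form_bigo_smallo:
  assumes "g \<in> O(\<lambda>n. real n ^ p)" and "h \<in> o(\<lambda>n. real n ^ q)"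
  shows "laguerre_form d g h \<in> o(\<lambda>n. real n ^ (p + q))"
  unfolding laguerre_form_def[abs_def] power_add
  using landau_o.big_small_mult[OF shift_bigo[OF assms(1)] shift_smallo[OF assms(2)]]
  by (intro big_sum_in_smallo) (simp del: Nat.add_diff_assoc)

lemma laguerre_form_smallo_bigo:
  assumes "g \<in> o(\<lambda>n. real n ^ p)" and "h \<in> O(\<lambda>n. real n ^ q)"
  shows "laguerre_form d g h \<in> o(\<lambda>n. real n ^ (p + q))"
  unfolding laguerre_form_def[abs_def] power_add
  using landau_o.small_big_mult[OF shift_smallo[OF assms(1)] shift_bigo[OF assms(2)]]
  by (intro big_sum_in_smallo) (simp del: Nat.add_diff_assoc)

section \<open>Asymptotics of the form on powers\<close>

lemma laguerre_form_powers_expansion: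
  "laguerre_form d (\<lambda>n. real n ^ k) (\<lambda>n. real n ^ m) n
    = (\<Sum>a\<le>k. \<Sum>b\<le>m. (-1) ^ d * real (k choose a) * real (m choose b)
        * (\<Sum>i\<le>2*d. (-1) ^ i * real ((2*d) choose i) * (real i ^ a * real (2*d - i) ^ b))
        * real n ^ ((k - a) + (m - b)))"
proof -
  have binom: "real (n + i) ^ q = (\<Sum>a\<le>q. real (q choose a) * real i ^ a * real n ^ (q - a))" for i q
    by (simp add: binomial_ring add.commute[of "real n"])
  have "laguerre_form d (\<lambda>n. real n ^ k) (\<lambda>n. real n ^ m) n
      = (\<Sum>i\<le>2*d. \<Sum>a\<le>k. \<Sum>b\<le>m. (-1) ^ d * real (k choose a) * real (m choose b)
        * ((-1) ^ i * real ((2*d) choose i) * (real i ^ a * real (2*d - i) ^ b))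
        * real n ^ ((k - a) + (m - b)))"
    unfolding laguerre_form_def binom sum_product
    unfolding sum_distrib_left power_add
    by (intro sum.cong refl) (simp only: mult_ac)
  also have "\<dots> = (\<Sum>a\<le>k. \<Sum>b\<le>m. \<Sum>i\<le>2*d. (-1) ^ d * real (k choose a) * real (m choose b)
        * ((-1) ^ i * real ((2*d) choose i) * (real i ^ a * real (2*d - i) ^ b))
        * real n ^ ((k - a) + (m - b)))"
    by (subst sum.swap) (intro sum.cong refl sum.swap)
  finally show ?thesis
    by (simp only: sum_distrib_left sum_distrib_right)
qed

text \<open>
  In the expansion above, the terms with \<open>a + b < 2d\<close> vanish, those with \<open>a + b = 2d\<close> give
  exactly the main term, and those with \<open>a + b > 2d\<close> have smaller order in \<open>n\<close>. If
  \<open>k + m < 2d\<close>, then only the first kind occurs, so the truncated exponent \<open>0\<close> does no harm: both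
  the form and the main term are zero.
\<close>

lemma laguerre_form_powers_asymp:
  "(\<lambda>n. laguerre_form d (\<lambda>n. real n ^ k) (\<lambda>n. real n ^ m) n
      - (-1) ^ d * fact (2*d)
        * (\<Sum>a\<le>k. \<Sum>b\<le>m. if a + b = 2*d then (-1) ^ b * real (k choose a) * real (m choose b) else 0)
        * real n ^ (k + m - 2*d))
    \<in> o(\<lambda>n. real n ^ (k + m - 2*d))"
proof -
  define S where "S a b = (\<Sum>i\<le>2*d. (-1) ^ i * real ((2*d) choose i) * (real i ^ a * real (2*d - i) ^ b))"
    for a b
  have summand: "(\<lambda>n. (-1) ^ d * real (k choose a) * real (m choose b) * S a b * real n ^ ((k - a) + (m - b))
      - (-1) ^ d * fact (2*d) * (if a + b = 2*d then (-1) ^ b * real (k choose a) * real (m choose b) else 0)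
        * real n ^ (k + m - 2*d)) \<in> o(\<lambda>n. real n ^ (k + m - 2*d))"
    (is "?t \<in> _") if ab: "a \<le> k" "b \<le> m" for a b
  proof (cases "a + b \<le> 2*d")
    case True
    have "?t = (\<lambda>_. 0)"
    proof (cases "a + b = 2*d")
      case eq: True
      then have "(k - a) + (m - b) = k + m - 2*d" using ab by simp
      then show ?thesis
        using eq alternating_binomial_sum_power_reflected[of a b "2*d"]
        by (simp add: S_def power_add mult_ac)
    next
      case False
      then show ?thesis
        using True alternating_binomial_sum_power_reflected[of a b "2*d"]
        by (simp add: S_def)
    qed
    then show ?thesis by simp
  next
    case False
    with ab have "(k - a) + (m - b) < k + m - 2*d" by simp
    from power_smallo_power[OF this] False show ?thesis by simp
  qed
  have "(\<lambda>n. \<Sum>a\<le>k. \<Sum>b\<le>m.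
      (-1) ^ d * real (k choose a) * real (m choose b) * S a b * real n ^ ((k - a) + (m - b))
      - (-1) ^ d * fact (2*d) * (if a + b = 2*d then (-1) ^ b * real (k choose a) * real (m choose b) else 0)
        * real n ^ (k + m - 2*d)) \<in> o(\<lambda>n. real n ^ (k + m - 2*d))"
    by (intro big_sum_in_smallo summand) auto
  then show ?thesis
    by (simp only: laguerre_form_powers_expansion S_def sum_distrib_left sum_distrib_right sum_subtractf)
qed

lemma laguerre_form_top_power:
  assumes "d \<le> l"
  shows "(\<lambda>n. laguerre_form d (\<lambda>n. real n ^ l) (\<lambda>n. real n ^ l) n
      - fact (2*d) * real (l choose d) * real n ^ (2 * (l - d))) \<in> o(\<lambda>n. real n ^ (2 * (l - d)))"
proof -
  have exponent: "l + l - 2*d = 2 * (l - d)" by simp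
  have "(-1) ^ d * (-1) ^ d = (1 :: real)"
    by (simp flip: power_mult_distrib)
  then have "(-1) ^ d * fact (2*d) * ((-1) ^ d * real (l choose d)) = fact (2*d) * real (l choose d)"
    by (metis mult.assoc mult.commute mult_1)
  then show ?thesis
    using laguerre_form_powers_asymp[of d l l]
    unfolding alternating_vandermonde_diagonal[OF assms] exponent by (simp only:)
qed

text \<open>
  The two hypotheses on the exponents make the order \<open>k + m - 2d\<close> strictly smaller than
  \<open>2(l - d)\<close>, even when the subtraction truncates, since \<open>k + m < 2l\<close> forces \<open>l > 0\<close> and
  therefore \<open>d < l\<close>.
\<close>

lemma laguerre_form_lower_powers:
  assumes "k + m < 2 * l" "2 * d \<le> l"
  shows "laguerre_form d (\<lambda>n. real n ^ k) (\<lambda>n. real n ^ m) \<in> o(\<lambda>n. real n ^ (2 * (l - d)))"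
proof -
  have less: "k + m - 2*d < 2 * (l - d)" using assms by simp
  define C where "C = (-1) ^ d * fact (2*d)
    * (\<Sum>a\<le>k. \<Sum>b\<le>m. if a + b = 2*d then (-1) ^ b * real (k choose a) * real (m choose b) else 0)"
  have small: "(\<lambda>n. real n ^ (k + m - 2*d)) \<in> o(\<lambda>n. real n ^ (2 * (l - d)))"
    by (rule power_smallo_power[OF less])
  have "(\<lambda>n. (laguerre_form d (\<lambda>n. real n ^ k) (\<lambda>n. real n ^ m) n - C * real n ^ (k + m - 2*d))
      + C * real n ^ (k + m - 2*d)) \<in> o(\<lambda>n. real n ^ (2 * (l - d)))"
    using landau_o.small_trans[OF laguerre_form_powers_asymp[of d k m, folded C_def] small] small
    by (intro sum_in_smallo(1)) simp_all
  then show ?thesis by simp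
qed

section \<open>Sequences with a polynomial expansion\<close>

lemma laguerre_form_poly_asymp:
  fixes c :: "nat \<Rightarrow> real"
  assumes "2 * d \<le> l"
  defines "P \<equiv> \<lambda>n. \<Sum>k=l-2*d..l. c k * real n ^ k"
  shows "(\<lambda>n. laguerre_form d P P n
      - fact (2*d) * real (l choose d) * (c l)\<^sup>2 * real n ^ (2 * (l - d))) \<in> o(\<lambda>n. real n ^ (2 * (l - d)))"
proof -
  let ?I = "{l-2*d..l}"
  define K where "K = fact (2*d) * real (l choose d)"
  define B where "B k m = laguerre_form d (\<lambda>n. real n ^ k) (\<lambda>n. real n ^ m)" for k m
  \<comment> \<open>the contribution of the pair of powers \<open>k\<close>, \<open>m\<close>, less the main term where that pair carries it\<close>
  define E where "E k m n = c k * (c m * (B k m n - (if k = l \<and> m = l then K * real n ^ (2 * (l - d)) else 0)))"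
    for k m n
  have "E k m \<in> o(\<lambda>n. real n ^ (2 * (l - d)))" if "k \<in> ?I" "m \<in> ?I" for k m
  proof (cases "k = l \<and> m = l")
    case True
    then show ?thesis
      using laguerre_form_top_power[of d l] assms(1)
      by (simp add: E_def[abs_def] B_def K_def)
  next
    case False
    with that have "k + m < 2 * l" by auto
    then have "B k m \<in> o(\<lambda>n. real n ^ (2 * (l - d)))"
      unfolding B_def using assms(1) by (rule laguerre_form_lower_powers)
    moreover have "E k m = (\<lambda>n. c k * (c m * B k m n))"
      using False by (auto simp: E_def[abs_def])
    ultimately show ?thesis by simp
  qed
  then have "(\<lambda>n. \<Sum>k\<in>?I. \<Sum>m\<in>?I. E k m n) \<in> o(\<lambda>n. real n ^ (2 * (l - d)))"
    by (intro big_sum_in_smallo)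
  moreover have "(\<Sum>k\<in>?I. \<Sum>m\<in>?I. E k m n)
      = laguerre_form d P P n - K * (c l)\<^sup>2 * real n ^ (2 * (l - d))" for n
  proof -
    have "laguerre_form d P P n = (\<Sum>k\<in>?I. \<Sum>m\<in>?I. c k * (c m * B k m n))"
      unfolding P_def laguerre_form_sum_left laguerre_form_sum_right B_def sum_distrib_left ..
    moreover have "(\<Sum>k\<in>?I. \<Sum>m\<in>?I. c k * (c m * (if k = l \<and> m = l then K * real n ^ (2 * (l - d)) else 0)))
        = (\<Sum>k\<in>?I. if k = l then c l * (c l * (K * real n ^ (2 * (l - d)))) else 0)"
      by (intro sum.cong refl) (simp add: if_distrib cong: if_cong)
    ultimately show ?thesis
      by (simp add: E_def right_diff_distrib sum_subtractf power2_eq_square mult_ac)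
  qed
  ultimately show ?thesis by (simp add: K_def)
qed

text \<open>
  With \<open>f = P + e\<close>, where \<open>P\<close> is the polynomial part and \<open>e\<close> the error, bilinearity gives
  \<open>B f f = B P P + B P e + B e f\<close>. Each of the last two terms pairs \<open>e\<close> with a sequence of size
  \<open>O(n^l)\<close>.
\<close>

lemma laguerre_expr_asymp:
  assumes "2 * d \<le> l"
    and "(\<lambda>n. f n - (\<Sum>k=l-2*d..l. c k * real n ^ k)) \<in> o(\<lambda>n. real n ^ (l - 2*d))"
  shows "(\<lambda>n. laguerre_expr d f n
      - fact (2*d) * real (l choose d) * (c l)\<^sup>2 * real n ^ (2 * (l - d))) \<in> o(\<lambda>n. real n ^ (2 * (l - d)))"
proof -
  define P where "P n = (\<Sum>k=l-2*d..l. c k * real n ^ k)" for n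
  define e where "e n = f n - P n" for n
  have e: "e \<in> o(\<lambda>n. real n ^ (l - 2*d))"
    using assms(2) by (simp add: e_def[abs_def] P_def)
  have P: "P \<in> O(\<lambda>n. real n ^ l)"
    unfolding P_def[abs_def] by (intro big_sum_in_bigo) (simp add: power_bigo_power)
  have "e \<in> O(\<lambda>n. real n ^ l)"
    using landau_o.big_trans[OF landau_o.small_imp_big[OF e] power_bigo_power[of _ l]] by simp
  with P have "(\<lambda>n. P n + e n) \<in> O(\<lambda>n. real n ^ l)"
    by (rule sum_in_bigo)
  moreover have f: "(\<lambda>n. P n + e n) = f" by (simp add: e_def)
  ultimately have "f \<in> O(\<lambda>n. real n ^ l)" by simp
  then have err: "laguerre_form d P e \<in> o(\<lambda>n. real n ^ (2 * (l - d)))"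
      "laguerre_form d e f \<in> o(\<lambda>n. real n ^ (2 * (l - d)))"
    using laguerre_form_bigo_smallo[OF P e, of d] laguerre_form_smallo_bigo[OF e, of f l d] assms(1)
    by (simp_all add: diff_mult_distrib2 mult_2)
  have split: "laguerre_expr d f n = laguerre_form d P P n + laguerre_form d P e n + laguerre_form d e f n" for n
    using laguerre_form_add_left[of d P e f n] laguerre_form_add_right[of d P P e n]
    by (simp add: f laguerre_expr_eq_form)
  have "(\<lambda>n. (laguerre_form d P P n - fact (2*d) * real (l choose d) * (c l)\<^sup>2 * real n ^ (2 * (l - d)))
      + laguerre_form d P e n + laguerre_form d e f n) \<in> o(\<lambda>n. real n ^ (2 * (l - d)))"
    using laguerre_form_poly_asymp[OF assms(1), of c] err
    by (intro sum_in_smallo(1)) (simp_all add: P_def[abs_def])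
  then show ?thesis by (simp add: split algebra_simps)
qed

text \<open>
  The discarded powers \<open>n^p, ..., n^(q - 1)\<close> are themselves \<open>o(n^q)\<close> and join the error term.
\<close>

lemma truncate_expansion:
  assumes "(\<lambda>n. f n - (\<Sum>k=p..l. c k * real n ^ k)) \<in> o(\<lambda>n. real n ^ p)" and "p \<le> q" "q \<le> l"
  shows "(\<lambda>n. f n - (\<Sum>k=q..l. c k * real n ^ k)) \<in> o(\<lambda>n. real n ^ q)"
proof -
  have "(\<Sum>k=p..l. c k * real n ^ k) = (\<Sum>k=p..<q. c k * real n ^ k) + (\<Sum>k=q..l. c k * real n ^ k)" for n
    using assms(2,3) sum.atLeastLessThan_concat[of p q "Suc l" "\<lambda>k. c k * real n ^ k"]
    by (simp add: atLeastLessThanSuc_atLeastAtMost)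
  moreover have "(\<lambda>n. \<Sum>k=p..<q. c k * real n ^ k) \<in> o(\<lambda>n. real n ^ q)"
    by (intro big_sum_in_smallo) (simp add: power_smallo_power)
  moreover have "(\<lambda>n. f n - (\<Sum>k=p..l. c k * real n ^ k)) \<in> o(\<lambda>n. real n ^ q)"
    using landau_o.small_big_trans[OF assms(1) power_bigo_power[OF assms(2)]] .
  ultimately show ?thesis
    using sum_in_smallo(1)[of "\<lambda>n. f n - (\<Sum>k=p..l. c k * real n ^ k)" sequentially _
        "\<lambda>n. \<Sum>k=p..<q. c k * real n ^ k"] by simp
qed

lemma eventually_nonneg_of_smallo_diff:
  fixes u v :: "nat \<Rightarrow> real"
  assumes "(\<lambda>n. u n - K * v n) \<in> o(v)" "K > 0" "\<And>n. v n \<ge> 0"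
  shows "eventually (\<lambda>n. u n \<ge> 0) sequentially"
  using landau_o.smallD[OF assms(1,2)]
proof eventually_elim
  case (elim n)
  then show ?case using assms(3)[of n] by (simp add: abs_le_iff)
qed

theorem theorem4p3:
  fixes d l :: nat and f :: "nat \<Rightarrow> real" and c :: "nat \<Rightarrow> real"
  assumes "2 * d \<le> l"
    and "(\<lambda>n. f n - (\<Sum>k=l-2*d..l. c k * real n ^ k)) \<in> o(\<lambda>n. real n ^ (l - 2*d))"
    and "c l \<noteq> 0"
  shows "(\<forall>j\<le>d. finite {n. \<not> satisfies_laguerre j f n}) \<and>
    (\<lambda>n. (\<Sum>i=0..2*d. (-1) ^ (i + d) * real ((2*d) choose i) * f (n + i) * f (n + 2*d - i))
          - fact (2*d) * real (l choose d) * (c l)\<^sup>2 * real n ^ (2 * (l - d)))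
      \<in> o(\<lambda>n. real n ^ (2 * (l - d)))"
proof (intro conjI allI impI)
  show "(\<lambda>n. (\<Sum>i=0..2*d. (-1) ^ (i + d) * real ((2*d) choose i) * f (n + i) * f (n + 2*d - i))
          - fact (2*d) * real (l choose d) * (c l)\<^sup>2 * real n ^ (2 * (l - d)))
      \<in> o(\<lambda>n. real n ^ (2 * (l - d)))"
    using laguerre_expr_asymp[OF assms(1,2)] by (simp only: laguerre_expr_def)
next
  fix j assume "j \<le> d"
  with assms(1) have j: "2 * j \<le> l" by simp
  have "(\<lambda>n. f n - (\<Sum>k=l-2*j..l. c k * real n ^ k)) \<in> o(\<lambda>n. real n ^ (l - 2*j))"
    using \<open>j \<le> d\<close> by (intro truncate_expansion[OF assms(2)]) auto
  from laguerre_expr_asymp[OF j this] have "eventually (\<lambda>n. laguerre_expr j f n \<ge> 0) sequentially"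
    using j assms(3) by (intro eventually_nonneg_of_smallo_diff) auto
  then show "finite {n. \<not> satisfies_laguerre j f n}"
    unfolding satisfies_laguerre_def cofinite_eq_sequentially[symmetric] eventually_cofinite .
qed

end
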